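(* Let $\theta\ge1$ and let $(X_i,d_i)$, $i\in\mathbb N$, and $(X,d)$ be compact $\theta$-metric spaces. If $(X_i,d_i)_i$ converges to $(X,d)$ in the $\theta$-Gromov-Hausdorff topology, then the sequence of symmetrized spaces $(X_i,\hat d_i)_i$ converges to $(X,\hat d)$ in the $1$-Gromov-Hausdorff topology (i.e. the original Gromov-Hausdorff topology), where $\hat d(x,y)=\tfrac12[d(x,y)+d(y,x)]$ and likewise for $\hat d_i$.
   Context: An irreversible metric on $X$ is $d:X\times X\to[0,\infty)$ with $d(x,y)=0$ iff $x=y$ and $d(x,z)\le d(x,y)+d(y,z)$ (no symmetry). The topology is generated by the forward balls $\{y:d(x,y)<r\}$. $(X,d)$ is a $\theta$-metric space if $d(x,y)\le\theta\,d(y,x)$ for all $x,y$. For $A\subset X$, $A^\epsilon=\{x\in X:\inf_{a\in A}d(a,x)<\epsilon\}$ and $d_H(A,B)=\inf\{\epsilon>0:A\subset B^\epsilon,B\subset A^\epsilon\}$. A $\theta$-admissible metric on $X_1\sqcup X_2$ is an irreversible metric making $X_1\sqcup X_2$ a $\theta$-metric space and restricting to $d_i$ on $X_i$. The $\theta$-Gromov-Hausdorff distance $d^\theta_{GH}$ of two compact $\theta$-metric spaces is the infimum of $d_H(X_1,X_2)$ over $\theta$-admissible metrics on $X_1\sqcup X_2$; convergence in the $\theta$-Gromov-Hausdorff topology means $d^\theta_{GH}\to0$. *)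

theory Defs
  imports "HOL-Analysis.Analysis"
begin

text \<open>A space is a carrier set together with a function on the ambient type; only the values of
  the function on the carrier matter.\<close>

definition irreversible_metric_on :: "'a set \<Rightarrow> ('a \<Rightarrow> 'a \<Rightarrow> real) \<Rightarrow> bool" where
  "irreversible_metric_on X d \<longleftrightarrow>
     (\<forall>x\<in>X. \<forall>y\<in>X. 0 \<le> d x y) \<and>
     (\<forall>x\<in>X. \<forall>y\<in>X. d x y = 0 \<longleftrightarrow> x = y) \<and>
     (\<forall>x\<in>X. \<forall>y\<in>X. \<forall>z\<in>X. d x z \<le> d x y + d y z)"

definition theta_metric_space :: "real \<Rightarrow> 'a set \<Rightarrow> ('a \<Rightarrow> 'a \<Rightarrow> real) \<Rightarrow> bool" where
  "theta_metric_space \<theta> X d \<longleftrightarrow>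
     irreversible_metric_on X d \<and> (\<forall>x\<in>X. \<forall>y\<in>X. d x y \<le> \<theta> * d y x)"

definition forward_ball :: "'a set \<Rightarrow> ('a \<Rightarrow> 'a \<Rightarrow> real) \<Rightarrow> 'a \<Rightarrow> real \<Rightarrow> 'a set" where
  "forward_ball X d x r = {y \<in> X. d x y < r}"

definition forward_topology :: "'a set \<Rightarrow> ('a \<Rightarrow> 'a \<Rightarrow> real) \<Rightarrow> 'a topology" where
  "forward_topology X d = topology_generated_by {forward_ball X d x r | x r. x \<in> X \<and> 0 < r}"

definition compact_theta_metric_space :: "real \<Rightarrow> 'a set \<Rightarrow> ('a \<Rightarrow> 'a \<Rightarrow> real) \<Rightarrow> bool" where
  "compact_theta_metric_space \<theta> X d \<longleftrightarrow>
     theta_metric_space \<theta> X d \<and> compact_space (forward_topology X d)"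

text \<open>All infima are taken in the extended reals, so that the infimum of the empty set is
  \<open>\<infinity>\<close>. In particular the empty space is admitted; it is at infinite distance from every
  nonempty space and at distance 0 from itself.\<close>

definition eps_nbhd :: "'a set \<Rightarrow> ('a \<Rightarrow> 'a \<Rightarrow> real) \<Rightarrow> 'a set \<Rightarrow> real \<Rightarrow> 'a set" where
  "eps_nbhd X d A \<epsilon> = {x \<in> X. (INF a\<in>A. ereal (d a x)) < ereal \<epsilon>}"

definition hausdorff_distance ::
  "'a set \<Rightarrow> ('a \<Rightarrow> 'a \<Rightarrow> real) \<Rightarrow> 'a set \<Rightarrow> 'a set \<Rightarrow> ereal" where
  "hausdorff_distance X d A B =
     (INF \<epsilon>\<in>{\<epsilon>. 0 < \<epsilon> \<and> A \<subseteq> eps_nbhd X d B \<epsilon> \<and> B \<subseteq> eps_nbhd X d A \<epsilon>}. ereal \<epsilon>)"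

definition theta_admissible ::
  "real \<Rightarrow> 'a set \<Rightarrow> ('a \<Rightarrow> 'a \<Rightarrow> real) \<Rightarrow> 'b set \<Rightarrow> ('b \<Rightarrow> 'b \<Rightarrow> real) \<Rightarrow>
     ('a + 'b \<Rightarrow> 'a + 'b \<Rightarrow> real) \<Rightarrow> bool" where
  "theta_admissible \<theta> X\<^sub>1 d\<^sub>1 X\<^sub>2 d\<^sub>2 \<rho> \<longleftrightarrow>
     theta_metric_space \<theta> (X\<^sub>1 <+> X\<^sub>2) \<rho> \<and>
     (\<forall>x\<in>X\<^sub>1. \<forall>y\<in>X\<^sub>1. \<rho> (Inl x) (Inl y) = d\<^sub>1 x y) \<and>
     (\<forall>x\<in>X\<^sub>2. \<forall>y\<in>X\<^sub>2. \<rho> (Inr x) (Inr y) = d\<^sub>2 x y)"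

definition theta_GH_distance ::
  "real \<Rightarrow> 'a set \<Rightarrow> ('a \<Rightarrow> 'a \<Rightarrow> real) \<Rightarrow> 'b set \<Rightarrow> ('b \<Rightarrow> 'b \<Rightarrow> real) \<Rightarrow> ereal" where
  "theta_GH_distance \<theta> X\<^sub>1 d\<^sub>1 X\<^sub>2 d\<^sub>2 =
     (INF \<rho>\<in>{\<rho>. theta_admissible \<theta> X\<^sub>1 d\<^sub>1 X\<^sub>2 d\<^sub>2 \<rho>}.
        hausdorff_distance (X\<^sub>1 <+> X\<^sub>2) \<rho> (Inl ` X\<^sub>1) (Inr ` X\<^sub>2))"

text \<open>Since the distance is a notion for compact \<open>\<theta>\<close>-metric spaces, convergence includes
  the requirement that all spaces involved are such. The members of the sequence live in one type,
  which can be taken to be a disjoint union; the limit may live in another type.\<close>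

definition theta_GH_converges ::
  "real \<Rightarrow> (nat \<Rightarrow> 'a set) \<Rightarrow> (nat \<Rightarrow> 'a \<Rightarrow> 'a \<Rightarrow> real) \<Rightarrow>
     'b set \<Rightarrow> ('b \<Rightarrow> 'b \<Rightarrow> real) \<Rightarrow> bool" where
  "theta_GH_converges \<theta> Xs ds X d \<longleftrightarrow>
     (\<forall>i. compact_theta_metric_space \<theta> (Xs i) (ds i)) \<and>
     compact_theta_metric_space \<theta> X d \<and>
     (\<lambda>i. theta_GH_distance \<theta> (Xs i) (ds i) X d) \<longlonglongrightarrow> 0"

definition symmetrization :: "('a \<Rightarrow> 'a \<Rightarrow> real) \<Rightarrow> 'a \<Rightarrow> 'a \<Rightarrow> real" where
  "symmetrization d x y = 1 / 2 * (d x y + d y x)"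

end

theory Submission
  imports Defs
begin

text \<open>Symmetrizing a \<open>\<theta>\<close>-admissible metric yields a 1-admissible metric for the symmetrized
  spaces. Since \<open>d \<le> 2 * symmetrization d \<le> (1 + \<theta>) * d\<close>, the topology does not change, and
  Hausdorff distances grow by at most the factor \<open>(1 + \<theta>) / 2\<close>.\<close>

lemma symmetrization_le:
  assumes "theta_metric_space \<theta> X d" "x \<in> X" "y \<in> X"
  shows "symmetrization d x y \<le> (1 + \<theta>) / 2 * d x y"
proof -
  have "d y x \<le> \<theta> * d x y"
    using assms unfolding theta_metric_space_def by blast
  then show ?thesis
    unfolding symmetrization_def by (simp add: algebra_simps)
qed

lemma le_symmetrization:
  assumes "irreversible_metric_on X d" "x \<in> X" "y \<in> X"
  shows "d x y \<le> 2 * symmetrization d x y"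
proof -
  have "0 \<le> d y x"
    using assms unfolding irreversible_metric_on_def by blast
  then show ?thesis
    unfolding symmetrization_def by simp
qed

lemma theta_metric_space_symmetrization:
  assumes "irreversible_metric_on X d"
  shows "theta_metric_space 1 X (symmetrization d)"
proof -
  have pos: "0 \<le> d x y" and zero: "d x y = 0 \<longleftrightarrow> x = y" if "x \<in> X" "y \<in> X" for x y
    using assms that unfolding irreversible_metric_on_def by blast+
  have tri: "d x z \<le> d x y + d y z" if "x \<in> X" "y \<in> X" "z \<in> X" for x y z
    using assms that unfolding irreversible_metric_on_def by blast
  \<comment> \<open>The two summands are nonnegative, so the average vanishes only if both
    do.\<close>
  have "symmetrization d x y = 0 \<longleftrightarrow> x = y" if "x \<in> X" "y \<in> X" for x y
  proof -
    have "d x y + d y x = 0 \<longleftrightarrow> d x y = 0 \<and> d y x = 0"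
      using pos that by (intro add_nonneg_eq_0_iff)
    then show ?thesis
      using zero that unfolding symmetrization_def by auto
  qed
  \<comment> \<open>Without symmetry of \<open>d\<close>, the triangle inequality is needed along x,
    y, z and along z, y, x; averaging the two gives the claim.\<close>
  moreover have "symmetrization d x z \<le> symmetrization d x y + symmetrization d y z"
    if "x \<in> X" "y \<in> X" "z \<in> X" for x y z
    using tri[of x y z] tri[of z y x] that unfolding symmetrization_def by argo
  moreover have "symmetrization d x y \<le> 1 * symmetrization d y x" for x y
    unfolding symmetrization_def by simp
  ultimately show ?thesis
    using pos unfolding theta_metric_space_def irreversible_metric_on_def
    by (simp add: symmetrization_def)
qed

text \<open>By definition the forward balls are only a subbasis. The triangle inequality makes them
  a base, since a forward ball contains a smaller one around each of its points. This local
  criterion is what allows two topologies to be compared ball by ball.\<close>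

lemma openin_forward_topology:
  assumes "irreversible_metric_on X d"
  shows "openin (forward_topology X d) U \<longleftrightarrow>
    U \<subseteq> X \<and> (\<forall>x\<in>U. \<exists>r>0. forward_ball X d x r \<subseteq> U)"
proof
  let ?B = "{forward_ball X d x r | x r. x \<in> X \<and> 0 < r}"
  assume "openin (forward_topology X d) U"
  then have "generate_topology_on ?B U"
    unfolding forward_topology_def openin_topology_generated_by_iff .
  then show "U \<subseteq> X \<and> (\<forall>x\<in>U. \<exists>r>0. forward_ball X d x r \<subseteq> U)"
  proof induction
    case Empty
    show ?case by simp
  next
    case (Int U V)
    have "\<exists>r>0. forward_ball X d x r \<subseteq> U \<inter> V" if x: "x \<in> U \<inter> V" for x
    proof -
      obtain r where "0 < r" "forward_ball X d x r \<subseteq> U"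
        using Int.IH(1) x by blast
      moreover obtain s where "0 < s" "forward_ball X d x s \<subseteq> V"
        using Int.IH(2) x by blast
      ultimately show ?thesis
        by (intro exI[of _ "min r s"]) (auto simp: forward_ball_def)
    qed
    then show ?case using Int.IH by (simp add: le_infI1)
  next
    case (UN K)
    have "\<exists>r>0. forward_ball X d x r \<subseteq> \<Union>K" if x: "x \<in> \<Union>K" for x
    proof -
      obtain U where "U \<in> K" "x \<in> U"
        using x by blast
      moreover from this obtain r where "0 < r" "forward_ball X d x r \<subseteq> U"
        using UN.IH by blast
      ultimately show ?thesis by blast
    qed
    then show ?case using UN.IH by (simp add: Sup_least)
  next
    case (Basis U)
    then obtain x r where U: "U = forward_ball X d x r" "x \<in> X"
      by blast
    have "\<exists>s>0. forward_ball X d y s \<subseteq> U" if "y \<in> U" for y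
    proof (intro exI conjI subsetI)
      \<comment> \<open>The radius is the slack left at y: going from x to y and then less than
        \<open>r - d x y\<close> further stays within distance r of x.\<close>
      show "0 < r - d x y"
        using that by (simp add: U forward_ball_def)
      fix z
      assume z: "z \<in> forward_ball X d y (r - d x y)"
      have "d x z \<le> d x y + d y z"
        using assms that U z unfolding irreversible_metric_on_def forward_ball_def by blast
      with z show "z \<in> U"
        by (simp add: U forward_ball_def)
    qed
    then show ?case by (auto simp: U forward_ball_def)
  qed
next
  assume U: "U \<subseteq> X \<and> (\<forall>x\<in>U. \<exists>r>0. forward_ball X d x r \<subseteq> U)"
  show "openin (forward_topology X d) U"
  \<comment> \<open>U is covered by the balls it contains around its points;
    \<open>d x x = 0\<close> puts each centre in its own ball.\<close>
  proof (subst openin_subopen, intro ballI)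
    fix x
    assume x: "x \<in> U"
    with U obtain r where r: "0 < r" "forward_ball X d x r \<subseteq> U" by blast
    from U x have "x \<in> X" by blast
    then have "d x x = 0"
      using assms unfolding irreversible_metric_on_def by blast
    have "openin (forward_topology X d) (forward_ball X d x r)"
      using \<open>x \<in> X\<close> r unfolding forward_topology_def by (intro topology_generated_by_Basis) blast
    moreover have "x \<in> forward_ball X d x r"
      using \<open>x \<in> X\<close> \<open>d x x = 0\<close> r unfolding forward_ball_def by simp
    ultimately show "\<exists>T. openin (forward_topology X d) T \<and> x \<in> T \<and> T \<subseteq> U"
      using r by blast
  qed
qed

text \<open>The two metrics bound each other up to constant factors, so around every point each ball
  of one contains a ball of the other. Compactness then carries over to the symmetrized
  space.\<close>

lemma forward_topology_symmetrization:
  assumes d: "theta_metric_space \<theta> X d" and "1 \<le> \<theta>"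
  shows "forward_topology X (symmetrization d) = forward_topology X d"
proof -
  have irr: "irreversible_metric_on X d"
    using d unfolding theta_metric_space_def by blast
  then have irr': "irreversible_metric_on X (symmetrization d)"
    using theta_metric_space_symmetrization unfolding theta_metric_space_def by blast
  \<comment> \<open>The radius is halved because d is at most twice its symmetrization; dually,
    \<open>sub'\<close> divides by the factor (1 + \<theta>) / 2 of
    \<open>symmetrization_le\<close>.\<close>
  have sub: "forward_ball X (symmetrization d) x (r / 2) \<subseteq> forward_ball X d x r" if "x \<in> X" for x r
    using le_symmetrization[OF irr that] by (fastforce simp: forward_ball_def)
  have sub': "forward_ball X d x (r / ((1 + \<theta>) / 2)) \<subseteq> forward_ball X (symmetrization d) x r"
    if "x \<in> X" for x r
  proof
    fix y
    assume y: "y \<in> forward_ball X d x (r / ((1 + \<theta>) / 2))"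
    then have "(1 + \<theta>) / 2 * d x y < r"
      using \<open>1 \<le> \<theta>\<close> by (simp add: forward_ball_def field_simps)
    with y show "y \<in> forward_ball X (symmetrization d) x r"
      using symmetrization_le[OF d that, of y] by (simp add: forward_ball_def)
  qed
  have iff: "(\<exists>r>0. forward_ball X (symmetrization d) x r \<subseteq> U) \<longleftrightarrow> (\<exists>r>0. forward_ball X d x r \<subseteq> U)"
    if "x \<in> X" for x U
  proof
    assume "\<exists>r>0. forward_ball X (symmetrization d) x r \<subseteq> U"
    then obtain r where "0 < r" "forward_ball X (symmetrization d) x r \<subseteq> U" by blast
    moreover from this have "0 < r / ((1 + \<theta>) / 2)"
      using \<open>1 \<le> \<theta>\<close> by simp
    ultimately show "\<exists>r>0. forward_ball X d x r \<subseteq> U"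
      using sub'[OF that] by blast
  next
    assume "\<exists>r>0. forward_ball X d x r \<subseteq> U"
    then obtain r where "0 < r" "forward_ball X d x r \<subseteq> U" by blast
    then show "\<exists>r>0. forward_ball X (symmetrization d) x r \<subseteq> U"
      using sub[OF that] by (meson half_gt_zero order_trans)
  qed
  show ?thesis
    \<comment> \<open>\<open>conj_cong\<close> makes U \<subseteq> X available while the second
      conjuncts are compared, which places the points of U in X as \<open>iff\<close>
      demands.\<close>
    unfolding topology_eq openin_forward_topology[OF irr] openin_forward_topology[OF irr']
    by (intro allI conj_cong refl ball_cong iff) (rule subsetD)
qed

lemma compact_theta_metric_space_symmetrization:
  assumes "compact_theta_metric_space \<theta> X d" "1 \<le> \<theta>"
  shows "compact_theta_metric_space 1 X (symmetrization d)"
proof -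
  have d: "theta_metric_space \<theta> X d" "compact_space (forward_topology X d)"
    using assms(1) unfolding compact_theta_metric_space_def by blast+
  then have "theta_metric_space 1 X (symmetrization d)"
    unfolding theta_metric_space_def[of \<theta>] by (blast intro: theta_metric_space_symmetrization)
  with d show ?thesis
    unfolding compact_theta_metric_space_def
    by (simp add: forward_topology_symmetrization[OF d(1) \<open>1 \<le> \<theta>\<close>])
qed

text \<open>Symmetrization is computed pointwise from the two values at a pair, so it commutes with
  restriction to each summand.\<close>

lemma theta_admissible_symmetrization:
  assumes "theta_admissible \<theta> X\<^sub>1 d\<^sub>1 X\<^sub>2 d\<^sub>2 \<rho>"
  shows "theta_admissible 1 X\<^sub>1 (symmetrization d\<^sub>1) X\<^sub>2 (symmetrization d\<^sub>2) (symmetrization \<rho>)"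
proof -
  have "theta_metric_space 1 (X\<^sub>1 <+> X\<^sub>2) (symmetrization \<rho>)"
    using assms unfolding theta_admissible_def theta_metric_space_def[of \<theta>]
    by (blast intro: theta_metric_space_symmetrization)
  with assms show ?thesis
    unfolding theta_admissible_def by (simp add: symmetrization_def)
qed

text \<open>An infimum lies strictly below a bound exactly when some member does. For empty A the
  infimum is \<infinity> and both sides fail.\<close>

lemma eps_nbhd_iff:
  "x \<in> eps_nbhd X d A \<epsilon> \<longleftrightarrow> x \<in> X \<and> (\<exists>a\<in>A. d a x < \<epsilon>)"
  unfolding eps_nbhd_def by (simp add: INF_less_iff)

text \<open>The point a that witnesses membership for d also serves for the symmetrization, at a
  radius enlarged by the factor.\<close>

lemma eps_nbhd_symmetrization:
  assumes d: "theta_metric_space \<theta> X d" and "1 \<le> \<theta>" "A \<subseteq> X"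
  shows "eps_nbhd X d A \<epsilon> \<subseteq> eps_nbhd X (symmetrization d) A ((1 + \<theta>) / 2 * \<epsilon>)"
proof
  fix x
  assume "x \<in> eps_nbhd X d A \<epsilon>"
  then obtain a where a: "x \<in> X" "a \<in> A" "d a x < \<epsilon>"
    unfolding eps_nbhd_iff by blast
  have "symmetrization d a x \<le> (1 + \<theta>) / 2 * d a x"
    using symmetrization_le[OF d] a \<open>A \<subseteq> X\<close> by blast
  also have "\<dots> < (1 + \<theta>) / 2 * \<epsilon>"
    using a \<open>1 \<le> \<theta>\<close> by (intro mult_strict_left_mono) auto
  finally show "x \<in> eps_nbhd X (symmetrization d) A ((1 + \<theta>) / 2 * \<epsilon>)"
    using a unfolding eps_nbhd_iff by blast
qed

lemma hausdorff_distance_symmetrization: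
  assumes d: "theta_metric_space \<theta> X d" and "1 \<le> \<theta>" "A \<subseteq> X" "B \<subseteq> X"
  shows "hausdorff_distance X (symmetrization d) A B
    \<le> ereal ((1 + \<theta>) / 2) * hausdorff_distance X d A B"
proof -
  let ?c = "(1 + \<theta>) / 2"
  have c: "0 < ereal ?c" using \<open>1 \<le> \<theta>\<close> by simp
  \<comment> \<open>Dividing by the positive factor isolates the infimum on the right, so it
    suffices to bound each radius \<epsilon>; such a radius yields the radius
    \<open>?c * \<epsilon>\<close> for the symmetrization.\<close>
  have "hausdorff_distance X (symmetrization d) A B / ereal ?c \<le> hausdorff_distance X d A B"
    unfolding hausdorff_distance_def[of X d]
  proof (rule INF_greatest)
    fix \<epsilon>
    assume "\<epsilon> \<in> {\<epsilon>. 0 < \<epsilon> \<and> A \<subseteq> eps_nbhd X d B \<epsilon> \<and> B \<subseteq> eps_nbhd X d A \<epsilon>}"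
    then have \<epsilon>: "0 < \<epsilon>" "A \<subseteq> eps_nbhd X d B \<epsilon>" "B \<subseteq> eps_nbhd X d A \<epsilon>"
      by auto
    have "0 < ?c * \<epsilon>"
      using \<epsilon> \<open>1 \<le> \<theta>\<close> by simp
    moreover have "A \<subseteq> eps_nbhd X (symmetrization d) B (?c * \<epsilon>)"
      "B \<subseteq> eps_nbhd X (symmetrization d) A (?c * \<epsilon>)"
      using \<epsilon> assms by (blast dest: eps_nbhd_symmetrization[THEN subsetD])+
    ultimately have "hausdorff_distance X (symmetrization d) A B \<le> ereal (?c * \<epsilon>)"
      unfolding hausdorff_distance_def by (intro INF_lower) blast
    then show "hausdorff_distance X (symmetrization d) A B / ereal ?c \<le> ereal \<epsilon>"
      using c by (subst ereal_divide_le_pos) auto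
  qed
  then show ?thesis
    using c by (subst (asm) ereal_divide_le_pos) auto
qed

text \<open>Each \<theta>-admissible \<rho> supplies the competitor
  \<open>symmetrization \<rho>\<close> for the infimum on the left, and its Hausdorff distance is
  controlled by that of \<rho>. If no such \<rho> exists, the right side is \<infinity>.\<close>

lemma theta_GH_distance_symmetrization:
  assumes "1 \<le> \<theta>"
  shows "theta_GH_distance 1 X\<^sub>1 (symmetrization d\<^sub>1) X\<^sub>2 (symmetrization d\<^sub>2)
    \<le> ereal ((1 + \<theta>) / 2) * theta_GH_distance \<theta> X\<^sub>1 d\<^sub>1 X\<^sub>2 d\<^sub>2"
    (is "?G \<le> ereal ?c * _")
proof -
  have c: "0 < ereal ?c" using assms by simp
  have "?G / ereal ?c \<le> theta_GH_distance \<theta> X\<^sub>1 d\<^sub>1 X\<^sub>2 d\<^sub>2"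
    unfolding theta_GH_distance_def[of \<theta>]
  proof (rule INF_greatest)
    fix \<rho>
    let ?H = "\<lambda>\<rho>. hausdorff_distance (X\<^sub>1 <+> X\<^sub>2) \<rho> (Inl ` X\<^sub>1) (Inr ` X\<^sub>2)"
    assume "\<rho> \<in> {\<rho>. theta_admissible \<theta> X\<^sub>1 d\<^sub>1 X\<^sub>2 d\<^sub>2 \<rho>}"
    then have \<rho>: "theta_admissible \<theta> X\<^sub>1 d\<^sub>1 X\<^sub>2 d\<^sub>2 \<rho>" by simp
    have "?G \<le> ?H (symmetrization \<rho>)"
      unfolding theta_GH_distance_def
      using theta_admissible_symmetrization[OF \<rho>] by (intro INF_lower) simp
    also have "\<dots> \<le> ereal ?c * ?H \<rho>"
      using \<rho> assms unfolding theta_admissible_def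
      by (intro hausdorff_distance_symmetrization) auto
    finally show "?G / ereal ?c \<le> ?H \<rho>"
      using c by (subst ereal_divide_le_pos) auto
  qed
  then show ?thesis
    using c by (subst (asm) ereal_divide_le_pos) auto
qed

lemma theta_GH_distance_nonneg: "0 \<le> theta_GH_distance \<theta> X\<^sub>1 d\<^sub>1 X\<^sub>2 d\<^sub>2"
  unfolding theta_GH_distance_def hausdorff_distance_def by (intro INF_greatest) auto

theorem proposition3p8:
  fixes \<theta> :: real
    and Xs :: "nat \<Rightarrow> 'a set" and ds :: "nat \<Rightarrow> 'a \<Rightarrow> 'a \<Rightarrow> real"
    and X :: "'b set" and d :: "'b \<Rightarrow> 'b \<Rightarrow> real"
  assumes "1 \<le> \<theta>"
    and "\<And>i. compact_theta_metric_space \<theta> (Xs i) (ds i)"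
    and "compact_theta_metric_space \<theta> X d"
    and "theta_GH_converges \<theta> Xs ds X d"
  shows "theta_GH_converges 1 Xs (\<lambda>i. symmetrization (ds i)) X (symmetrization d)"
proof -
  have "(\<lambda>i. theta_GH_distance \<theta> (Xs i) (ds i) X d) \<longlonglongrightarrow> 0"
    using assms(4) unfolding theta_GH_converges_def by blast
  \<comment> \<open>The factor depends on \<theta> alone, not on i, and is finite, so the limit 0
    survives the multiplication.\<close>
  then have "(\<lambda>i. ereal ((1 + \<theta>) / 2) * theta_GH_distance \<theta> (Xs i) (ds i) X d)
      \<longlonglongrightarrow> ereal ((1 + \<theta>) / 2) * 0"
    by (intro tendsto_cmult_ereal) auto
  then have upper: "(\<lambda>i. ereal ((1 + \<theta>) / 2) * theta_GH_distance \<theta> (Xs i) (ds i) X d) \<longlonglongrightarrow> 0"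
    by simp
  \<comment> \<open>The distances are squeezed between 0 and the multiple just shown to
    vanish.\<close>
  have "(\<lambda>i. theta_GH_distance 1 (Xs i) (symmetrization (ds i)) X (symmetrization d)) \<longlonglongrightarrow> 0"
    by (rule tendsto_sandwich[OF _ _ tendsto_const upper])
      (simp_all only: theta_GH_distance_nonneg theta_GH_distance_symmetrization[OF \<open>1 \<le> \<theta>\<close>]
        eventually_True)
  moreover have "compact_theta_metric_space 1 (Xs i) (symmetrization (ds i))" for i
    using assms(2) \<open>1 \<le> \<theta>\<close> by (rule compact_theta_metric_space_symmetrization)
  moreover have "compact_theta_metric_space 1 X (symmetrization d)"
    using assms(3) \<open>1 \<le> \<theta>\<close> by (rule compact_theta_metric_space_symmetrization)
  ultimately show ?thesis
    unfolding theta_GH_converges_def by simp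
qed

end
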